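(* Let $(S,\mathcal B_S,\mu)$ be a standard Lebesgue space with $\sigma$-finite measure $\mu$, and $f,g:S\to[0,\infty)$ measurable with $\int_S f\,d\mu=\int_S g\,d\mu=1$. Let $(X,Y)$ satisfy \[ \mathbb P(X\le x,Y\le y)=\exp\Big\{-\int_S \max\Big(\frac{f(s)}{x},\frac{g(s)}{y}\Big)\mu(ds)\Big\},\qquad x,y>0 . \] Let $E_t=\{s\in S: f(s)>t\,g(s)\}$ and define $\gamma(t)=\frac1t\int_S f\,\mathbf 1_{\{f>tg\}}\,d\mu$. Suppose $\mu(E_t)>0$ for all $t\in(0,\infty)$. For $u\ge0$ put $X(u)=\max(X,u)$, $Y(u)=\max(Y,u)$. Then, for $\alpha\ge 0$, $X(u)/Y(u)\in RV_{-\alpha}$ for some $u\ge0$ if and only if $X(u)/Y(u)\in RV_{-\alpha}$ for all $u\ge 0$, if and only if $\gamma\in RV_{-\alpha}$.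
   Context: A measurable $U:\mathbb R_+\to\mathbb R_+$ is in $RV_{-\rho}$ if $U(tx)/U(t)\to x^{-\rho}$ as $t\to\infty$ for all $x>0$; a nonnegative random variable $Z$ is in $RV_{-\rho}$ if $t\mapsto\mathbb P(Z>t)$ is in $RV_{-\rho}$. Convention $1/0=\infty$, $X(0)=X$. *)

theory Defs
  imports "HOL-Probability.Probability"
begin

definition regvar :: "real \<Rightarrow> (real \<Rightarrow> real) \<Rightarrow> bool" where
  "regvar rho U \<longleftrightarrow>
     U \<in> borel_measurable (restrict_space borel {0<..}) \<and>
     (\<forall>t>0. 0 \<le> U t) \<and>
     (\<forall>x>0. ((\<lambda>t. U (t * x) / U t) \<longlongrightarrow> x powr (- rho)) at_top)"

definition rv_regvar :: "'a measure \<Rightarrow> real \<Rightarrow> ('a \<Rightarrow> real) \<Rightarrow> bool" where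
  "rv_regvar M rho Z \<longleftrightarrow> regvar rho (\<lambda>t. measure M {\<omega> \<in> space M. Z \<omega> > t})"

definition gamma_fun :: "'s measure \<Rightarrow> ('s \<Rightarrow> real) \<Rightarrow> ('s \<Rightarrow> real) \<Rightarrow> real \<Rightarrow> real" where
  "gamma_fun N f g t =
     (1 / t) * (\<integral>s. f s * indicator {s \<in> space N. f s > t * g s} s \<partial>N)"

end

theory Submission
  imports Defs
begin

text \<open>
  Write \<open>c t\<close> for the integral of \<open>max (f / t) g\<close>. Homogeneity of the exponent measure
  makes the law of \<open>max (X / t) Y\<close> equal to \<open>exp (- c t / z)\<close>, independent of which of the two
  terms is the larger, so that \<open>P (X > t * max Y u) = \<gamma> t / c t * (1 - exp (- c t / u))\<close>.
  Since \<open>c t \<rightarrow> 1\<close>, the tail of \<open>X(u) / Y(u)\<close> is asymptotically a positive constant times \<open>\<gamma>\<close>.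
  The formula is obtained without densities: along the levels \<open>z r\<^sup>k\<close> the increments of both sides
  are compared, uniformly up to a factor that tends to one as \<open>r\<close> decreases to one.
\<close>

section \<open>Regular variation under asymptotic proportionality\<close>

lemma regvar_transfer:
  assumes U: "regvar \<rho> U"
    and W: "W \<in> borel_measurable (restrict_space borel {0<..})" "\<And>t. t > 0 \<Longrightarrow> 0 \<le> W t"
    and eq: "eventually (\<lambda>t. W t = k t * U t) at_top"
    and k: "(k \<longlongrightarrow> \<kappa>) at_top" "\<kappa> \<noteq> 0"
  shows "regvar \<rho> W"
proof -
  have "((\<lambda>t. W (t * x) / W t) \<longlongrightarrow> x powr - \<rho>) at_top" if x: "x > 0" for x
  proof -
    have fl: "filterlim (\<lambda>t. t * x) at_top at_top"
      using x by (simp add: filterlim_at_top_mult_tendsto_pos[OF tendsto_const _ filterlim_ident])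
    have kx: "((\<lambda>t. k (t * x)) \<longlongrightarrow> \<kappa>) at_top"
      by (rule filterlim_compose[OF k(1) fl])
    have Ux: "((\<lambda>t. U (t * x) / U t) \<longlongrightarrow> x powr - \<rho>) at_top"
      using U x by (simp add: regvar_def)
    have "((\<lambda>t. k (t * x) / k t * (U (t * x) / U t)) \<longlongrightarrow> \<kappa> / \<kappa> * x powr - \<rho>) at_top"
      by (intro tendsto_mult tendsto_divide kx k Ux)
    \<comment> \<open>The identity survives a vanishing denominator: if \<open>U t = 0\<close> or
      \<open>k t = 0\<close> then \<open>W t = 0\<close>, and both sides are zero by the convention
      for division.\<close>
    moreover have "eventually (\<lambda>t. k (t * x) / k t * (U (t * x) / U t) = W (t * x) / W t) at_top"
      using eq eventually_compose_filterlim[OF eq fl] by eventually_elim simp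
    ultimately show ?thesis
      using k(2) by (auto elim: Lim_transform_eventually)
  qed
  with W show ?thesis by (auto simp: regvar_def)
qed

text \<open>A nonzero limit makes \<open>k\<close> eventually invertible, so the relation can be
  read backwards with factor \<open>inverse (k t)\<close> and the one-sided transfer applies in both
  directions.\<close>

lemma regvar_cong_asymp:
  assumes "U \<in> borel_measurable (restrict_space borel {0<..})" "\<And>t. t > 0 \<Longrightarrow> 0 \<le> U t"
    and "W \<in> borel_measurable (restrict_space borel {0<..})" "\<And>t. t > 0 \<Longrightarrow> 0 \<le> W t"
    and eq: "eventually (\<lambda>t. W t = k t * U t) at_top"
    and k: "(k \<longlongrightarrow> \<kappa>) at_top" "\<kappa> \<noteq> 0"
  shows "regvar \<rho> W \<longleftrightarrow> regvar \<rho> U"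
proof
  have "eventually (\<lambda>t. k t \<noteq> 0) at_top"
    using k tendsto_imp_eventually_ne by blast
  with eq have eq': "eventually (\<lambda>t. U t = inverse (k t) * W t) at_top"
    by eventually_elim simp
  show "regvar \<rho> W \<Longrightarrow> regvar \<rho> U"
    by (rule regvar_transfer[OF _ assms(1,2) eq' tendsto_inverse]) (use k in auto)
  show "regvar \<rho> U \<Longrightarrow> regvar \<rho> W"
    by (rule regvar_transfer[OF _ assms(3-7)]) auto
qed

section \<open>Measurability, exponential estimates and limits from the right\<close>

lemma borel_measurable_antimono_on:
  fixes U :: "real \<Rightarrow> real"
  assumes "\<And>s t. s \<in> A \<Longrightarrow> t \<in> A \<Longrightarrow> s \<le> t \<Longrightarrow> U t \<le> U s"
  shows "U \<in> borel_measurable (restrict_space borel A)"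
proof -
  have "mono_on A (\<lambda>t. - U t)"
    using assms by (intro mono_onI) simp
  then have "(\<lambda>t. - U t) \<in> borel_measurable (restrict_space borel A)"
    by (rule borel_measurable_mono_on_fnc)
  then show ?thesis by simp
qed

text \<open>Both are \<open>1 + x \<le> exp x\<close>, at \<open>x = b - a\<close> and at
  \<open>x = a - b\<close>. The order of \<open>a\<close> and \<open>b\<close> is left open.\<close>

lemma exp_minus_diff_bounds:
  fixes a b :: real
  shows "(b - a) * exp (- b) \<le> exp (- a) - exp (- b)"
    and "exp (- a) - exp (- b) \<le> (b - a) * exp (- a)"
proof -
  have "exp (- b) * (1 + (b - a)) \<le> exp (- b) * exp (b - a)"
    by (intro mult_left_mono exp_ge_add_one_self) simp
  then show "(b - a) * exp (- b) \<le> exp (- a) - exp (- b)"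
    by (simp add: algebra_simps flip: exp_add)
  have "exp (- a) * (1 + (a - b)) \<le> exp (- a) * exp (a - b)"
    by (intro mult_left_mono exp_ge_add_one_self) simp
  then show "exp (- a) - exp (- b) \<le> (b - a) * exp (- a)"
    by (simp add: algebra_simps flip: exp_add)
qed

text \<open>Continuity from below: as the thresholds fall to \<open>h\<close> the events grow, and
  strictness of the inequality makes their union exactly the event for \<open>h\<close>. It serves
  two limits later, slopes decreasing to \<open>t\<close> and truncation levels decreasing to
  zero.\<close>

lemma (in finite_measure) tendsto_measure_exceed_decreasing:
  fixes X h :: "'a \<Rightarrow> real" and H :: "nat \<Rightarrow> 'a \<Rightarrow> real"
  assumes [measurable]: "X \<in> borel_measurable M" "\<And>n. H n \<in> borel_measurable M"
    and dec: "\<And>\<omega>. decseq (\<lambda>n. H n \<omega>)" and lim: "\<And>\<omega>. (\<lambda>n. H n \<omega>) \<longlonglongrightarrow> h \<omega>"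
  shows "(\<lambda>n. measure M {\<omega>\<in>space M. X \<omega> > H n \<omega>}) \<longlonglongrightarrow> measure M {\<omega>\<in>space M. X \<omega> > h \<omega>}"
proof -
  let ?A = "\<lambda>n. {\<omega>\<in>space M. X \<omega> > H n \<omega>}"
  have "incseq ?A"
    using dec by (auto simp: incseq_def decseq_def intro: le_less_trans)
  moreover have "range ?A \<subseteq> sets M" by auto
  moreover have "(\<Union>n. ?A n) = {\<omega>\<in>space M. X \<omega> > h \<omega>}"
  proof (intro equalityI subsetI)
    fix \<omega> assume "\<omega> \<in> {\<omega>\<in>space M. X \<omega> > h \<omega>}"
    then have \<omega>: "\<omega> \<in> space M" "h \<omega> < X \<omega>" by auto
    from order_tendstoD(2)[OF lim \<omega>(2)] obtain n where "H n \<omega> < X \<omega>"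
      by (auto simp: eventually_sequentially)
    with \<omega> show "\<omega> \<in> (\<Union>n. ?A n)" by auto
  next
    fix \<omega> assume "\<omega> \<in> (\<Union>n. ?A n)"
    then obtain n where "\<omega> \<in> space M" "H n \<omega> < X \<omega>" by auto
    moreover have "h \<omega> \<le> H n \<omega>" using decseq_ge[OF dec lim] .
    ultimately show "\<omega> \<in> {\<omega>\<in>space M. X \<omega> > h \<omega>}" by auto
  qed
  ultimately show ?thesis
    using finite_Lim_measure_incseq[of ?A] by simp
qed

lemma shrinking_multiples:
  fixes t :: real
  assumes "t > 0"
  defines "s \<equiv> \<lambda>n. t * (1 + 1 / real (Suc n))"
  shows "s \<longlonglongrightarrow> t" "decseq s" "\<And>n. t < s n"
proof -
  have "(\<lambda>n. t * (1 + 1 / real (Suc n))) \<longlonglongrightarrow> t * (1 + 0)"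
    by (intro tendsto_intros LIMSEQ_Suc[OF lim_1_over_n])
  then show "s \<longlonglongrightarrow> t" by (simp add: s_def)
  show "decseq s" using assms
    by (auto simp: s_def decseq_def intro!: mult_left_mono divide_left_mono)
  show "t < s n" for n using assms by (simp add: s_def field_simps)
qed

section \<open>The exponent function and its relation to \<open>\<gamma>\<close>\<close>

locale spectral_pair =
  fixes N :: "'s measure" and f g :: "'s \<Rightarrow> real"
  assumes f_meas [measurable]: "f \<in> borel_measurable N"
    and g_meas [measurable]: "g \<in> borel_measurable N"
    and f_nonneg: "\<And>s. s \<in> space N \<Longrightarrow> 0 \<le> f s"
    and g_nonneg: "\<And>s. s \<in> space N \<Longrightarrow> 0 \<le> g s"
    and f_one: "(\<integral>\<^sup>+ s. ennreal (f s) \<partial>N) = 1"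
    and g_one: "(\<integral>\<^sup>+ s. ennreal (g s) \<partial>N) = 1"
begin

text \<open>The exponent function of the pair, minus the logarithm of its distribution function, at
  the point \<open>(t, 1)\<close>; by homogeneity this one variable carries everything.\<close>

definition c :: "real \<Rightarrow> real" where
  "c t = (\<integral>s. max (f s / t) (g s) \<partial>N)"

abbreviation \<gamma> :: "real \<Rightarrow> real" where
  "\<gamma> \<equiv> gamma_fun N f g"

lemma f_integrable [simp]: "integrable N f" and f_integral: "(\<integral>s. f s \<partial>N) = 1"
  using integrableI_nn_integral_finite[of f N 1] integral_eq_nn_integral[of f N] f_nonneg f_one
  by (auto intro: AE_I2)

lemma g_integrable [simp]: "integrable N g" and g_integral: "(\<integral>s. g s \<partial>N) = 1"
  using integrableI_nn_integral_finite[of g N 1] integral_eq_nn_integral[of g N] g_nonneg g_one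
  by (auto intro: AE_I2)

lemma integrable_exceed [simp]:
  "integrable N (\<lambda>s. f s * indicator {s \<in> space N. f s > t * g s} s)"
  by (rule Bochner_Integration.integrable_bound[OF f_integrable])
     (auto intro!: AE_I2 simp: indicator_def)

lemma max_integrable [simp]: "integrable N (\<lambda>s. max (f s / t) (g s))"
  by (intro integrable_max integrable_divide f_integrable g_integrable)

lemma gamma_nonneg: "t > 0 \<Longrightarrow> 0 \<le> \<gamma> t"
  unfolding gamma_fun_def
  by (intro mult_nonneg_nonneg Bochner_Integration.integral_nonneg) (auto simp: f_nonneg)

lemma exponent_homogeneous:
  assumes "x > 0" "y > 0"
  shows "(\<integral>s. max (f s / x) (g s / y) \<partial>N) = c (x / y) / y"
proof -
  have "max (f s / x) (g s / y) = max (f s / (x / y)) (g s) / y" for s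
    using assms by (simp add: max_def field_simps)
  then show ?thesis by (simp add: c_def)
qed

text \<open>Where \<open>f > s * g\<close> both maxima are attained by the \<open>f\<close> term,
  and their difference is \<open>f * (1 / t - 1 / s)\<close>; elsewhere it is nonnegative.\<close>

lemma c_diff_lower:
  assumes "0 < t" "t < s"
  shows "\<gamma> s * (s / t - 1) \<le> c t - c s"
proof -
  have "\<gamma> s * (s / t - 1)
      = (\<integral>x. f x * indicator {x \<in> space N. f x > s * g x} x * (1 / t - 1 / s) \<partial>N)"
    using assms by (simp add: gamma_fun_def field_simps)
  also have "\<dots> \<le> (\<integral>x. max (f x / t) (g x) - max (f x / s) (g x) \<partial>N)"
  proof (rule integral_mono)
    fix x assume x: "x \<in> space N"
    have "f x / s \<le> f x / t"
      using assms f_nonneg[OF x] by (intro divide_left_mono) auto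
    moreover have "g x < f x / s" if "f x > s * g x"
      using that assms by (simp add: field_simps)
    ultimately show "f x * indicator {x \<in> space N. f x > s * g x} x * (1 / t - 1 / s)
        \<le> max (f x / t) (g x) - max (f x / s) (g x)"
      using x by (auto simp: indicator_def algebra_simps)
  qed simp_all
  also have "\<dots> = c t - c s" by (simp add: c_def)
  finally show ?thesis .
qed

text \<open>Outside \<open>f > t * g\<close> both maxima equal \<open>g\<close> and cancel; inside,
  the second maximum is at least \<open>f / s\<close>. With the lower bound this puts the difference
  quotient of \<open>c\<close> between \<open>- \<gamma> t / s\<close> and
  \<open>- \<gamma> s / t\<close>, so that \<open>- \<gamma> t / t\<close> acts as its right
  derivative.\<close>

lemma c_diff_upper:
  assumes "0 < t" "t < s"
  shows "c t - c s \<le> \<gamma> t * (1 - t / s)"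
proof -
  have "c t - c s = (\<integral>x. max (f x / t) (g x) - max (f x / s) (g x) \<partial>N)"
    by (simp add: c_def)
  also have "\<dots> \<le> (\<integral>x. f x * indicator {x \<in> space N. f x > t * g x} x * (1 / t - 1 / s) \<partial>N)"
  proof (rule integral_mono)
    fix x assume x: "x \<in> space N"
    have "f x / s \<le> f x / t"
      using assms f_nonneg[OF x] by (intro divide_left_mono) auto
    moreover have "f x > t * g x \<longleftrightarrow> g x < f x / t"
      using assms by (simp add: field_simps)
    ultimately show "max (f x / t) (g x) - max (f x / s) (g x)
        \<le> f x * indicator {x \<in> space N. f x > t * g x} x * (1 / t - 1 / s)"
      using x by (auto simp: indicator_def algebra_simps)
  qed simp_all
  also have "\<dots> = \<gamma> t * (1 - t / s)"
    using assms by (simp add: gamma_fun_def field_simps)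
  finally show ?thesis .
qed

lemma c_ge_one: "1 \<le> c t"
proof -
  have "(\<integral>s. g s \<partial>N) \<le> c t"
    unfolding c_def by (intro integral_mono) simp_all
  then show ?thesis by (simp add: g_integral)
qed

lemma c_pos: "0 < c t"
  using c_ge_one[of t] by simp

lemma c_le:
  assumes "0 < t" shows "c t \<le> 1 / t + 1"
proof -
  have "c t \<le> (\<integral>s. f s / t + g s \<partial>N)"
    unfolding c_def using assms f_nonneg g_nonneg by (intro integral_mono) auto
  then show ?thesis by (simp add: f_integral g_integral)
qed

lemma c_tendsto_one: "(c \<longlongrightarrow> 1) at_top"
proof (rule tendsto_sandwich)
  show "eventually (\<lambda>t. 1 \<le> c t) at_top" by (simp add: c_ge_one)
  show "eventually (\<lambda>t. c t \<le> 1 / t + 1) at_top"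
    using eventually_gt_at_top[of 0] by eventually_elim (rule c_le)
  have "((\<lambda>t::real. 1 / t + 1) \<longlongrightarrow> 0 + 1) at_top"
    by (intro tendsto_intros tendsto_divide_0[OF tendsto_const] filterlim_at_top_imp_at_infinity filterlim_ident)
  then show "((\<lambda>t::real. 1 / t + 1) \<longlongrightarrow> 1) at_top" by simp
qed simp

lemma c_right_limit:
  assumes "t > 0" "s \<longlonglongrightarrow> t" "\<And>n. t < s n"
  shows "(\<lambda>n. c (s n)) \<longlonglongrightarrow> c t"
proof (rule tendsto_sandwich)
  have pos: "0 < s n" for n using assms(1) assms(3)[of n] by simp
  show "eventually (\<lambda>n. c t - \<gamma> t * (1 - t / s n) \<le> c (s n)) sequentially"
    using c_diff_upper[OF assms(1,3)] by (intro always_eventually allI) (simp add: algebra_simps)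
  have "c (s n) \<le> c t" for n
  proof -
    have "0 \<le> \<gamma> (s n) * (s n / t - 1)"
      using assms(1) assms(3)[of n] gamma_nonneg[OF pos] by (intro mult_nonneg_nonneg) auto
    with c_diff_lower[OF assms(1,3), of n] show ?thesis by linarith
  qed
  then show "eventually (\<lambda>n. c (s n) \<le> c t) sequentially" by simp
  have "(\<lambda>n. c t - \<gamma> t * (1 - t / s n)) \<longlonglongrightarrow> c t - \<gamma> t * (1 - t / t)"
    using assms(1) by (intro tendsto_intros assms(2)) auto
  then show "(\<lambda>n. c t - \<gamma> t * (1 - t / s n)) \<longlonglongrightarrow> c t" using assms(1) by simp
qed simp

text \<open>For each point the indicator is eventually constant when \<open>s n\<close> approaches
  \<open>t\<close> from above, and \<open>f\<close> dominates. From the left this can fail on the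
  set where \<open>f = t * g\<close>, which is why all approximations run from the right.\<close>

lemma gamma_right_limit:
  assumes "t > 0" "s \<longlonglongrightarrow> t" "\<And>n. t < s n"
  shows "(\<lambda>n. \<gamma> (s n)) \<longlonglongrightarrow> \<gamma> t"
proof -
  have "(\<lambda>n. \<integral>x. f x * indicator {x \<in> space N. f x > s n * g x} x \<partial>N)
      \<longlonglongrightarrow> (\<integral>x. f x * indicator {x \<in> space N. f x > t * g x} x \<partial>N)"
  proof (rule integral_dominated_convergence[where w = f])
    show "AE x in N. (\<lambda>n. f x * indicator {x \<in> space N. f x > s n * g x} x)
        \<longlonglongrightarrow> f x * indicator {x \<in> space N. f x > t * g x} x"
    proof (rule AE_I2)
      fix x assume x: "x \<in> space N"
      have "eventually (\<lambda>n. (f x > s n * g x) = (f x > t * g x)) sequentially"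
      proof (cases "f x > t * g x")
        case True
        have "(\<lambda>n. s n * g x) \<longlonglongrightarrow> t * g x" by (intro tendsto_intros assms)
        from order_tendstoD(2)[OF this True] show ?thesis
          by (rule eventually_mono) (use True in simp)
      next
        case False
        have "t * g x \<le> s n * g x" for n
          using assms(3)[of n] g_nonneg[OF x] by (intro mult_right_mono) auto
        with False have "\<not> f x > s n * g x" for n
          by (meson le_less_trans)
        with False show ?thesis by simp
      qed
      then show "(\<lambda>n. f x * indicator {x \<in> space N. f x > s n * g x} x)
          \<longlonglongrightarrow> f x * indicator {x \<in> space N. f x > t * g x} x"
        by (intro tendsto_eventually) (auto elim!: eventually_mono simp: indicator_def)
    qed
    show "AE x in N. norm (f x * indicator {x \<in> space N. f x > s n * g x} x) \<le> f x" for n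
      by (auto intro!: AE_I2 simp: f_nonneg indicator_def)
  qed simp_all
  moreover have "(\<lambda>n. 1 / s n) \<longlonglongrightarrow> 1 / t"
    using assms by (intro tendsto_intros) auto
  ultimately show ?thesis
    unfolding gamma_fun_def by (intro tendsto_mult)
qed

lemma gamma_measurable: "\<gamma> \<in> borel_measurable (restrict_space borel {0<..})"
proof -
  have "(\<lambda>t. \<integral>x. f x * indicator {x \<in> space N. f x > t * g x} x \<partial>N)
      \<in> borel_measurable (restrict_space borel {0<..})"
  proof (rule borel_measurable_antimono_on, rule integral_mono)
    fix s t :: real and x
    assume "s \<le> t" and x: "x \<in> space N"
    then have "s * g x \<le> t * g x"
      using g_nonneg by (intro mult_right_mono) auto
    then show "f x * indicator {x \<in> space N. f x > t * g x} x
        \<le> f x * indicator {x \<in> space N. f x > s * g x} x"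
      using f_nonneg[OF x] by (auto simp: indicator_def)
  qed simp_all
  moreover have "(\<lambda>t::real. 1 / t) \<in> borel_measurable (restrict_space borel {0<..})"
    by (intro measurable_restrict_space1) simp
  ultimately show ?thesis
    unfolding gamma_fun_def[abs_def] by (intro borel_measurable_times)
qed

end

section \<open>The law of the pair and increments of the tail\<close>

locale spectral_rv = spectral_pair N f g + prob_space M
  for M :: "'a measure" and N :: "'s measure" and f g :: "'s \<Rightarrow> real" +
  fixes X Y :: "'a \<Rightarrow> real"
  assumes X_meas [measurable]: "X \<in> borel_measurable M"
    and Y_meas [measurable]: "Y \<in> borel_measurable M"
    and cdf: "\<And>x y. x > 0 \<Longrightarrow> y > 0 \<Longrightarrow>
      measure M {\<omega> \<in> space M. X \<omega> \<le> x \<and> Y \<omega> \<le> y} = exp (- (\<integral>s. max (f s / x) (g s / y) \<partial>N))"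
begin

lemma cdf_c:
  assumes "x > 0" "y > 0"
  shows "measure M {\<omega> \<in> space M. X \<omega> \<le> x \<and> Y \<omega> \<le> y} = exp (- (c (x / y) / y))"
  using cdf[OF assms] exponent_homogeneous[OF assms] by simp

text \<open>The tail at \<open>t\<close> of \<open>X / max Y z\<close>, in product form so that a
  vanishing denominator does no harm.\<close>

definition F :: "real \<Rightarrow> real \<Rightarrow> real" where
  "F t z = measure M {\<omega> \<in> space M. X \<omega> > t * max (Y \<omega>) z}"

lemma prob_strip:
  assumes "0 < a" "a \<le> b" "0 < y"
  shows "measure M {\<omega> \<in> space M. a < X \<omega> \<and> X \<omega> \<le> b \<and> Y \<omega> \<le> y}
    = exp (- (c (b / y) / y)) - exp (- (c (a / y) / y))"
proof -
  have "{\<omega> \<in> space M. a < X \<omega> \<and> X \<omega> \<le> b \<and> Y \<omega> \<le> y}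
      = {\<omega> \<in> space M. X \<omega> \<le> b \<and> Y \<omega> \<le> y} - {\<omega> \<in> space M. X \<omega> \<le> a \<and> Y \<omega> \<le> y}"
    by auto
  also have "measure M \<dots>
      = measure M {\<omega> \<in> space M. X \<omega> \<le> b \<and> Y \<omega> \<le> y} - measure M {\<omega> \<in> space M. X \<omega> \<le> a \<and> Y \<omega> \<le> y}"
    using assms(2) by (intro finite_measure_Diff) auto
  finally show ?thesis using assms by (simp add: cdf_c)
qed

text \<open>The event lost when the level rises from \<open>z\<close> to \<open>w\<close> is
  \<open>t * max Y z < X \<le> t * max Y w\<close>. It lies between two strips
  \<open>t * z < X \<le> t * w\<close>, one with \<open>Y \<le> z\<close> and one with
  \<open>Y \<le> w\<close>, whose probabilities are known.\<close>

lemma F_diff: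
  assumes "0 < t" "0 < z" "z \<le> w"
  shows "exp (- (c (t * w / z) / z)) - exp (- (c t / z)) \<le> F t z - F t w"
    and "F t z - F t w \<le> exp (- (c t / w)) - exp (- (c (t * z / w) / w))"
proof -
  let ?A = "\<lambda>z. {\<omega> \<in> space M. X \<omega> > t * max (Y \<omega>) z}"
  have mono: "t * max y z \<le> t * max y w" for y
    using assms by (intro mult_left_mono) auto
  have sub: "?A w \<subseteq> ?A z"
    using mono by (auto intro: le_less_trans)
  have diff: "F t z - F t w = measure M (?A z - ?A w)"
    unfolding F_def using sub by (intro finite_measure_Diff[symmetric]) auto
  have tz: "0 < t * z" "t * z \<le> t * w" "0 < w" using assms by auto
  have "measure M {\<omega> \<in> space M. t * z < X \<omega> \<and> X \<omega> \<le> t * w \<and> Y \<omega> \<le> z} \<le> measure M (?A z - ?A w)"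
  proof (intro finite_measure_mono subsetI)
    fix \<omega> assume "\<omega> \<in> {\<omega> \<in> space M. t * z < X \<omega> \<and> X \<omega> \<le> t * w \<and> Y \<omega> \<le> z}"
    then show "\<omega> \<in> ?A z - ?A w"
      using assms by (auto simp: max_def not_less)
  qed simp
  then show "exp (- (c (t * w / z) / z)) - exp (- (c t / z)) \<le> F t z - F t w"
    using prob_strip[OF tz(1,2) assms(2)] assms by (simp add: diff)
  have "measure M (?A z - ?A w) \<le> measure M {\<omega> \<in> space M. t * z < X \<omega> \<and> X \<omega> \<le> t * w \<and> Y \<omega> \<le> w}"
  proof (intro finite_measure_mono subsetI)
    fix \<omega> assume \<omega>: "\<omega> \<in> ?A z - ?A w"
    have "t * z \<le> t * max (Y \<omega>) z" "t * Y \<omega> \<le> t * max (Y \<omega>) z"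
      using assms by (auto intro!: mult_left_mono)
    \<comment> \<open>If \<open>Y\<close> exceeded \<open>w\<close>, the second and third
      inequalities would read \<open>t * Y < X \<le> t * Y\<close>.\<close>
    with \<omega> have "t * z < X \<omega>" "t * Y \<omega> < X \<omega>" "X \<omega> \<le> t * max (Y \<omega>) w" by auto
    then show "\<omega> \<in> {\<omega> \<in> space M. t * z < X \<omega> \<and> X \<omega> \<le> t * w \<and> Y \<omega> \<le> w}"
      using \<omega> by (auto simp: max_def split: if_splits)
  qed simp
  then show "F t z - F t w \<le> exp (- (c t / w)) - exp (- (c (t * z / w) / w))"
    using prob_strip[OF tz] assms by (simp add: diff)
qed

text \<open>The event forces \<open>X\<close> out of the square with side \<open>t * z\<close>. This
  crude bound only serves to show that \<open>F t z\<close> vanishes as \<open>z\<close>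
  grows.\<close>

lemma F_le:
  assumes "0 < t" "0 < z"
  shows "F t z \<le> 1 - exp (- (c 1 / (t * z)))"
proof -
  have "F t z \<le> measure M (space M - {\<omega> \<in> space M. X \<omega> \<le> t * z \<and> Y \<omega> \<le> t * z})"
    unfolding F_def
  proof (intro finite_measure_mono subsetI)
    fix \<omega> assume \<omega>: "\<omega> \<in> {\<omega> \<in> space M. X \<omega> > t * max (Y \<omega>) z}"
    have "t * z \<le> t * max (Y \<omega>) z" using assms by (intro mult_left_mono) auto
    with \<omega> show "\<omega> \<in> space M - {\<omega> \<in> space M. X \<omega> \<le> t * z \<and> Y \<omega> \<le> t * z}" by auto
  qed simp
  also have "\<dots> = 1 - exp (- (c 1 / (t * z)))"
    using assms cdf_c[of "t * z" "t * z"] by (subst prob_compl) auto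
  finally show ?thesis .
qed

section \<open>Comparison along geometric levels and the exact tail formula\<close>

lemma geometric_limits:
  assumes "0 < t" "0 < z" "1 < r"
  shows "(\<lambda>k. F t (z * r ^ k) + K * exp (- (a / (z * r ^ k)))) \<longlonglongrightarrow> K"
proof -
  have fl: "filterlim (\<lambda>k. z * r ^ k) at_infinity sequentially"
    using assms
    by (intro tendsto_mult_filterlim_at_infinity[OF tendsto_const] filterlim_realpow_sequentially_gt1) auto
  have lim: "(\<lambda>k. exp (- (b / (z * r ^ k)))) \<longlonglongrightarrow> exp (- 0)" for b
    by (intro tendsto_intros tendsto_divide_0[OF tendsto_const fl])
  have "(\<lambda>k. F t (z * r ^ k)) \<longlonglongrightarrow> 0"
  proof (rule tendsto_sandwich)
    show "eventually (\<lambda>k. 0 \<le> F t (z * r ^ k)) sequentially" by (simp add: F_def)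
    show "eventually (\<lambda>k. F t (z * r ^ k) \<le> 1 - exp (- (c 1 / t / (z * r ^ k)))) sequentially"
      using F_le[OF assms(1)] assms by (intro always_eventually allI) (simp add: mult.assoc)
    show "(\<lambda>k. 1 - exp (- (c 1 / t / (z * r ^ k)))) \<longlonglongrightarrow> 0"
      using tendsto_diff[OF tendsto_const[of 1] lim[of "c 1 / t"]] by simp
  qed simp
  then have "(\<lambda>k. F t (z * r ^ k) + K * exp (- (a / (z * r ^ k)))) \<longlonglongrightarrow> 0 + K * exp (- 0)"
    by (intro tendsto_add tendsto_mult tendsto_const lim)
  then show ?thesis by simp
qed

text \<open>The auxiliary function \<open>\<Phi>\<close> decreases along the levels
  \<open>z * r ^ k\<close> and tends to \<open>K\<close>, so its value at \<open>z\<close> is at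
  least \<open>K\<close>; this rearranges to the claim.\<close>

lemma F_lower:
  assumes "0 < t" "t < s" "0 < z"
  shows "s / t * \<gamma> s / c t * exp (- (c t * (1 - t / s) / z)) * (1 - exp (- (c t / z))) \<le> F t z"
proof -
  \<comment> \<open>With this ratio one step of the levels turns slope \<open>t\<close> into
    \<open>t * r = s\<close> inside \<open>F_diff\<close>, matching the increment
    \<open>c t - c s\<close>.\<close>
  define r where "r = s / t"
  \<comment> \<open>The factor \<open>s / t * \<gamma> s / c t\<close> is the quotient of
    \<open>\<gamma> s * (s / t - 1)\<close> by \<open>c t * (1 - t / s)\<close>. The exponential is
    the smallest value over \<open>x \<ge> z\<close>, taken at \<open>x = z\<close>, of the quotient
    of \<open>exp (- (c t / x))\<close> by \<open>exp (- (c t / (x * r)))\<close>.\<close>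
  define K where "K = s / t * \<gamma> s / c t * exp (- (c t * (1 - t / s) / z))"
  define \<Phi> where "\<Phi> = (\<lambda>x. F t x + K * exp (- (c t / x)))"
  have r: "1 < r" "t * r = s" "0 < s" using assms by (auto simp: r_def)
  have g: "0 \<le> \<gamma> s" using r by (intro gamma_nonneg)
  have step: "\<Phi> (x * r) \<le> \<Phi> x" if x: "z \<le> x" for x
  proof -
    have x0: "0 < x" using x assms by simp
    have "exp (- (c t / (x * r))) - exp (- (c t / x))
        \<le> (c t / x - c t / (x * r)) * exp (- (c t / (x * r)))"
      by (rule exp_minus_diff_bounds)
    also have "\<dots> = c t * (1 - t / s) / x * exp (- (c t / (x * r)))"
      using r x0 assms by (simp add: r_def field_simps)
    finally have "K * (exp (- (c t / (x * r))) - exp (- (c t / x)))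
        \<le> K * (c t * (1 - t / s) / x * exp (- (c t / (x * r))))"
      using g c_pos[of t] assms r by (intro mult_left_mono) (auto simp: K_def)
    also have "\<dots> \<le> s / t * \<gamma> s / c t * exp (- (c t * (1 - t / s) / x))
        * (c t * (1 - t / s) / x * exp (- (c t / (x * r))))"
    proof -
      have "c t * (1 - t / s) / x \<le> c t * (1 - t / s) / z"
        using c_pos[of t] assms x x0 r by (intro divide_left_mono mult_nonneg_nonneg) auto
      then show ?thesis
        using g c_pos[of t] assms r x0 unfolding K_def
        by (intro mult_right_mono mult_left_mono) (auto intro!: mult_nonneg_nonneg divide_nonneg_nonneg)
    qed
    also have "\<dots> = \<gamma> s * (s / t - 1) / x
        * exp (- (c t * (1 - t / s) / x) + - (c t / (x * r)))"
      using c_pos[of t] assms r x0 unfolding exp_add by (simp add: field_simps)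
    also have "- (c t * (1 - t / s) / x) + - (c t / (x * r)) = - (c t / x)"
      using assms r x0 by (simp add: r_def field_simps)
    also have "\<gamma> s * (s / t - 1) / x * exp (- (c t / x)) \<le> (c t - c s) / x * exp (- (c t / x))"
      using c_diff_lower[OF assms(1,2)] x0 by (intro mult_right_mono divide_right_mono) auto
    also have "\<dots> \<le> exp (- (c s / x)) - exp (- (c t / x))"
      using exp_minus_diff_bounds(1)[of "c t / x" "c s / x"] by (simp add: diff_divide_distrib)
    also have "\<dots> \<le> F t x - F t (x * r)"
      using F_diff(1)[OF assms(1) x0, of "x * r"] r x0 by (simp add: mult.left_commute)
    finally show ?thesis by (simp add: \<Phi>_def algebra_simps)
  qed
  have "decseq (\<lambda>k. \<Phi> (z * r ^ k))"
  proof (rule decseq_SucI)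
    fix k
    have "z \<le> z * r ^ k" using assms r by simp
    from step[OF this] show "\<Phi> (z * r ^ Suc k) \<le> \<Phi> (z * r ^ k)" by (simp add: ac_simps)
  qed
  from decseq_ge[OF this, of K 0] geometric_limits[OF assms(1,3) r(1)] have "K \<le> \<Phi> z"
    by (simp add: \<Phi>_def)
  then have "K * (1 - exp (- (c t / z))) \<le> F t z"
    by (simp add: \<Phi>_def right_diff_distrib)
  then show ?thesis by (simp only: K_def)
qed

text \<open>The mirror image of \<open>F_lower\<close>: \<open>\<Phi>\<close> now increases to
  \<open>K\<close>. The tail is taken at the larger slope \<open>s\<close> and
  \<open>\<gamma>\<close> at the smaller \<open>t\<close>, so that letting \<open>s\<close> decrease
  to \<open>t\<close> again needs only right limits.\<close>

lemma F_upper: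
  assumes "0 < t" "t < s" "0 < z"
  shows "F s z \<le> t / s * \<gamma> t / c s * exp (c s * (1 - t / s) / z) * (1 - exp (- (c s / z)))"
proof -
  define r where "r = s / t"
  define K where "K = t / s * \<gamma> t / c s * exp (c s * (1 - t / s) / z)"
  define \<Phi> where "\<Phi> = (\<lambda>x. F s x + K * exp (- (c s / x)))"
  have s: "0 < s" using assms by simp
  have r: "1 < r" "t * r = s" using assms by (auto simp: r_def)
  have g: "0 \<le> \<gamma> t" using assms by (intro gamma_nonneg)
  have step: "\<Phi> x \<le> \<Phi> (x * r)" if x: "z \<le> x" for x
  proof -
    have x0: "0 < x" using x assms by simp
    have "F s x - F s (x * r) \<le> exp (- (c s / (x * r))) - exp (- (c t / (x * r)))"
    proof -
      have "x \<le> x * r" using r x0 by simp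
      \<comment> \<open>The upper strip is cut at height \<open>x * r\<close>, so its lower corner
        has slope \<open>t\<close>.\<close>
      moreover have "s * x / (x * r) = t" using x0 assms by (simp add: r_def)
      ultimately show ?thesis using F_diff(2)[OF s x0, of "x * r"] by simp
    qed
    also have "\<dots> \<le> (c t - c s) / (x * r) * exp (- (c s / (x * r)))"
      using exp_minus_diff_bounds(2)[of "c s / (x * r)" "c t / (x * r)"] by (simp add: diff_divide_distrib)
    also have "\<dots> \<le> \<gamma> t * (1 - t / s) / (x * r) * exp (- (c s / (x * r)))"
      using c_diff_upper[OF assms(1,2)] x0 r by (intro mult_right_mono divide_right_mono) auto
    also have "- (c s / (x * r)) = c s * (1 - t / s) / x + - (c s / x)"
      using assms s x0 by (simp add: r_def field_simps)
    also have "\<gamma> t * (1 - t / s) / (x * r) * exp (c s * (1 - t / s) / x + - (c s / x))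
        = t / s * \<gamma> t / c s * exp (c s * (1 - t / s) / x)
          * (c s * (1 - t / s) / x * exp (- (c s / x)))"
      using c_pos[of s] assms s x0 unfolding exp_add by (simp add: r_def field_simps)
    also have "\<dots> \<le> K * (c s * (1 - t / s) / x * exp (- (c s / x)))"
    proof -
      have "c s * (1 - t / s) / x \<le> c s * (1 - t / s) / z"
        using c_pos[of s] assms x x0 s by (intro divide_left_mono mult_nonneg_nonneg) auto
      then show ?thesis
        using g c_pos[of s] assms s x0 unfolding K_def
        by (intro mult_right_mono mult_left_mono) (auto intro!: mult_nonneg_nonneg divide_nonneg_nonneg)
    qed
    also have "c s * (1 - t / s) / x * exp (- (c s / x)) = (c s / x - c s / (x * r)) * exp (- (c s / x))"
      using assms s x0 by (simp add: r_def field_simps)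
    also have "K * \<dots> \<le> K * (exp (- (c s / (x * r))) - exp (- (c s / x)))"
      using g c_pos[of s] assms s
      by (intro mult_left_mono exp_minus_diff_bounds) (auto simp: K_def)
    finally show ?thesis by (simp add: \<Phi>_def algebra_simps)
  qed
  have "incseq (\<lambda>k. \<Phi> (z * r ^ k))"
  proof (rule incseq_SucI)
    fix k
    have "z \<le> z * r ^ k" using assms r by simp
    from step[OF this] show "\<Phi> (z * r ^ k) \<le> \<Phi> (z * r ^ Suc k)" by (simp add: ac_simps)
  qed
  from incseq_le[OF this, of K 0] geometric_limits[OF s assms(3) r(1)] have "\<Phi> z \<le> K"
    by (simp add: \<Phi>_def)
  then have "F s z \<le> K * (1 - exp (- (c s / z)))"
    by (simp add: \<Phi>_def right_diff_distrib)
  then show ?thesis by (simp only: K_def)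
qed

text \<open>Squeeze with \<open>s\<close> decreasing to \<open>t\<close>: the factors
  \<open>s / t\<close> and the exponential corrections tend to one, and the two bounds meet.\<close>

lemma F_eq:
  assumes "0 < t" "0 < z"
  shows "F t z = \<gamma> t / c t * (1 - exp (- (c t / z)))"
proof -
  define s where "s = (\<lambda>n. t * (1 + 1 / real (Suc n)))"
  have s: "s \<longlonglongrightarrow> t" "decseq s" "\<And>n. t < s n"
    unfolding s_def using shrinking_multiples[OF assms(1)] by auto
  have cl: "(\<lambda>n. c (s n)) \<longlonglongrightarrow> c t" by (rule c_right_limit[OF assms(1) s(1,3)])
  have gl: "(\<lambda>n. \<gamma> (s n)) \<longlonglongrightarrow> \<gamma> t" by (rule gamma_right_limit[OF assms(1) s(1,3)])
  have ne: "c t \<noteq> 0" "t \<noteq> 0" "z \<noteq> 0" using c_pos[of t] assms by auto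
  show ?thesis
  proof (rule antisym)
    \<comment> \<open>In the upper bound it is the slope of the tail that moves; in the lower bound
      below, the tail stays at \<open>t\<close> and \<open>\<gamma>\<close> moves.\<close>
    have "(\<lambda>n. F (s n) z) \<longlonglongrightarrow> F t z"
      unfolding F_def
    proof (rule tendsto_measure_exceed_decreasing)
      show "decseq (\<lambda>n. s n * max (Y \<omega>) z)" for \<omega>
        using s(2) assms by (auto simp: decseq_def intro!: mult_right_mono)
      show "(\<lambda>n. s n * max (Y \<omega>) z) \<longlonglongrightarrow> t * max (Y \<omega>) z" for \<omega>
        by (intro tendsto_intros s)
    qed simp_all
    moreover have "(\<lambda>n. t / s n * \<gamma> t / c (s n) * exp (c (s n) * (1 - t / s n) / z)
          * (1 - exp (- (c (s n) / z))))
        \<longlonglongrightarrow> t / t * \<gamma> t / c t * exp (c t * (1 - t / t) / z) * (1 - exp (- (c t / z)))"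
      by (intro tendsto_intros cl s(1) ne)
    ultimately have "F t z \<le> t / t * \<gamma> t / c t * exp (c t * (1 - t / t) / z) * (1 - exp (- (c t / z)))"
      using F_upper[OF assms(1) s(3) assms(2)] by (intro LIMSEQ_le) auto
    then show "F t z \<le> \<gamma> t / c t * (1 - exp (- (c t / z)))" using ne by simp
    have "(\<lambda>n. s n / t * \<gamma> (s n) / c t * exp (- (c t * (1 - t / s n) / z)) * (1 - exp (- (c t / z))))
        \<longlonglongrightarrow> t / t * \<gamma> t / c t * exp (- (c t * (1 - t / t) / z)) * (1 - exp (- (c t / z)))"
      by (intro tendsto_intros gl s(1) ne)
    then have "t / t * \<gamma> t / c t * exp (- (c t * (1 - t / t) / z)) * (1 - exp (- (c t / z))) \<le> F t z"
      using F_lower[OF assms(1) s(3) assms(2)] by (intro LIMSEQ_le_const2) auto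
    then show "\<gamma> t / c t * (1 - exp (- (c t / z))) \<le> F t z" using ne by simp
  qed
qed

text \<open>Level zero is reached as a limit, the exponential term vanishing. Substituting
  \<open>z = 0\<close> in the formula would give zero, since \<open>c t / 0 = 0\<close>.\<close>

lemma F_eq_0:
  assumes "0 < t"
  shows "F t 0 = \<gamma> t / c t"
proof -
  define z where "z = (\<lambda>n. 1 / real (Suc n))"
  have z: "z \<longlonglongrightarrow> 0" "\<And>n. 0 < z n" "decseq z"
    unfolding z_def using LIMSEQ_Suc[OF lim_1_over_n]
    by (auto simp: decseq_def intro!: divide_left_mono)
  have "(\<lambda>n. F t (z n)) \<longlonglongrightarrow> F t 0"
    unfolding F_def
  proof (rule tendsto_measure_exceed_decreasing)
    show "decseq (\<lambda>n. t * max (Y \<omega>) (z n))" for \<omega>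
      using z(3) assms unfolding decseq_def by (intro allI impI mult_left_mono max.mono) auto
    show "(\<lambda>n. t * max (Y \<omega>) (z n)) \<longlonglongrightarrow> t * max (Y \<omega>) 0" for \<omega>
      by (intro tendsto_intros z)
  qed simp_all
  moreover have "(\<lambda>n. \<gamma> t / c t * (1 - exp (- (c t / z n)))) \<longlonglongrightarrow> \<gamma> t / c t * (1 - 0)"
  proof (intro tendsto_intros filterlim_compose[OF exp_at_bot])
    have "filterlim (\<lambda>n. c t / z n) at_top sequentially"
      by (rule LIM_at_top_divide[OF tendsto_const c_pos z(1)]) (simp add: z(2))
    then show "filterlim (\<lambda>n. - (c t / z n)) at_bot sequentially"
      by (simp add: filterlim_uminus_at_bot)
  qed
  moreover have "F t (z n) = \<gamma> t / c t * (1 - exp (- (c t / z n)))" for n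
    using F_eq[OF assms z(2)] .
  ultimately show ?thesis using LIMSEQ_unique by fastforce
qed

section \<open>Tail of the truncated ratio and the equivalence\<close>

lemma Y_pos: "AE \<omega> in M. 0 < Y \<omega>"
proof -
  have "AE \<omega> in M. \<not> (X \<omega> \<le> real n \<and> Y \<omega> \<le> 0)" if n: "n > 0" for n
  proof -
    let ?A = "{\<omega> \<in> space M. X \<omega> \<le> real n \<and> Y \<omega> \<le> 0}"
    \<comment> \<open>The law is given only at positive points, so \<open>Y \<le> 0\<close> is
      approached through \<open>Y \<le> 1 / x\<close>; there the exponent is at least
      \<open>x\<close> because \<open>c\<close> is at least one.\<close>
    have le: "measure M ?A \<le> exp (- x)" if "x > 0" for x
    proof -
      have "measure M ?A \<le> measure M {\<omega> \<in> space M. X \<omega> \<le> real n \<and> Y \<omega> \<le> 1 / x}"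
        using that by (intro finite_measure_mono subsetI) (auto intro: order_trans)
      also have "\<dots> = exp (- (c (real n / (1 / x)) * x))"
        using cdf_c[of "real n" "1 / x"] n that by simp
      also have "\<dots> \<le> exp (- x)"
        using c_ge_one that by simp
      finally show ?thesis .
    qed
    have "((\<lambda>x::real. exp (- x)) \<longlongrightarrow> 0) at_top"
      by (intro filterlim_compose[OF exp_at_bot]) (simp add: filterlim_uminus_at_bot filterlim_ident)
    then have "measure M ?A \<le> 0"
      by (rule tendsto_lowerbound[OF _ eventually_mono[OF eventually_gt_at_top[of "0::real"] le]]) simp_all
    then have "measure M ?A = 0" by (simp add: antisym)
    then have "?A \<in> null_sets M"
      by (intro null_setsI) (auto simp: emeasure_eq_measure)
    then show ?thesis by (intro AE_I'[of ?A]) auto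
  qed
  then have "AE \<omega> in M. \<forall>n>0. \<not> (X \<omega> \<le> real n \<and> Y \<omega> \<le> 0)"
    by (simp add: AE_all_countable)
  then show ?thesis
  proof eventually_elim
    case (elim \<omega>)
    \<comment> \<open>The \<open>1\<close> forces \<open>n > 0\<close>, as the null events
      demand.\<close>
    obtain n where "max 1 (X \<omega>) \<le> real n" using real_arch_simple by blast
    with elim show ?case by (metis gr0I max.bounded_iff not_le of_nat_0 zero_less_one)
  qed
qed

text \<open>For \<open>t \<ge> 1\<close> the threshold \<open>t * max Y u\<close> is already at
  least \<open>u\<close>, so truncating \<open>X\<close> cannot create an exceedance. Almost sure
  positivity of \<open>Y\<close> justifies clearing the denominator, also at
  \<open>u = 0\<close>.\<close>

lemma tail_eq_F:
  assumes "0 \<le> u" "1 \<le> t"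
  shows "measure M {\<omega> \<in> space M. max (X \<omega>) u / max (Y \<omega>) u > t} = F t u"
  unfolding F_def
proof (rule finite_measure_eq_AE)
  show "AE \<omega> in M. \<omega> \<in> {\<omega> \<in> space M. max (X \<omega>) u / max (Y \<omega>) u > t}
      \<longleftrightarrow> \<omega> \<in> {\<omega> \<in> space M. X \<omega> > t * max (Y \<omega>) u}"
    using Y_pos
  proof eventually_elim
    case (elim \<omega>)
    have pos: "0 < max (Y \<omega>) u" using elim by simp
    have "u \<le> 1 * max (Y \<omega>) u" by simp
    also have "\<dots> \<le> t * max (Y \<omega>) u" using assms pos by (intro mult_right_mono) auto
    finally have "u \<le> t * max (Y \<omega>) u" .
    then show ?case using pos by (auto simp: less_divide_eq less_max_iff_disj)
  qed
qed simp_all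

lemma rv_regvar_ratio_iff:
  assumes u: "0 \<le> u"
  shows "rv_regvar M \<alpha> (\<lambda>\<omega>. max (X \<omega>) u / max (Y \<omega>) u) \<longleftrightarrow> regvar \<alpha> \<gamma>"
proof -
  \<comment> \<open>The exact factor between the tail and \<open>\<gamma>\<close>; the case split
    keeps \<open>c t / 0\<close> from replacing the limit value \<open>1\<close>. Its limit depends
    on \<open>u\<close> but is never zero.\<close>
  define k where "k = (\<lambda>t. (if u = 0 then 1 else 1 - exp (- (c t / u))) / c t)"
  define \<kappa> where "\<kappa> = (if u = 0 then 1 else 1 - exp (- (1 / u)))"
  have "((\<lambda>t. 1 / c t) \<longlongrightarrow> 1 / 1) at_top"
    by (intro tendsto_intros c_tendsto_one) simp
  moreover have "((\<lambda>t. (1 - exp (- (c t / u))) / c t) \<longlongrightarrow> (1 - exp (- (1 / u))) / 1) at_top" if "u \<noteq> 0"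
    using that by (intro tendsto_intros c_tendsto_one) simp_all
  ultimately have k: "(k \<longlongrightarrow> \<kappa>) at_top"
    by (cases "u = 0") (auto simp: k_def \<kappa>_def)
  show ?thesis
    unfolding rv_regvar_def
  proof (rule regvar_cong_asymp[OF gamma_measurable gamma_nonneg _ _ _ k])
    show "(\<lambda>t. measure M {\<omega> \<in> space M. t < max (X \<omega>) u / max (Y \<omega>) u})
        \<in> borel_measurable (restrict_space borel {0<..})"
      by (rule borel_measurable_antimono_on, rule finite_measure_mono) auto
    show "eventually (\<lambda>t. measure M {\<omega> \<in> space M. t < max (X \<omega>) u / max (Y \<omega>) u} = k t * \<gamma> t) at_top"
      using eventually_ge_at_top[of 1]
    proof eventually_elim
      case (elim t)
      then show ?case
        using tail_eq_F[OF u elim] F_eq_0[of t] F_eq[of t u] u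
        by (auto simp: k_def)
    qed
    show "\<kappa> \<noteq> 0" using u by (auto simp: \<kappa>_def)
  qed simp_all
qed

end

theorem theorem1:
  fixes M :: "'a measure" and N :: "'s::polish_space measure"
    and X Y :: "'a \<Rightarrow> real" and f g :: "'s \<Rightarrow> real" and \<alpha> :: real
  assumes "prob_space M"
    and "X \<in> borel_measurable M" and "Y \<in> borel_measurable M"
    and "sets N = sets borel" and "sigma_finite_measure N"
    and "f \<in> borel_measurable N" and "g \<in> borel_measurable N"
    and "\<forall>s\<in>space N. 0 \<le> f s" and "\<forall>s\<in>space N. 0 \<le> g s"
    and "(\<integral>\<^sup>+ s. ennreal (f s) \<partial>N) = 1" and "(\<integral>\<^sup>+ s. ennreal (g s) \<partial>N) = 1"
    and "\<forall>x>0. \<forall>y>0. measure M {\<omega> \<in> space M. X \<omega> \<le> x \<and> Y \<omega> \<le> y}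
           = exp (- (\<integral>s. max (f s / x) (g s / y) \<partial>N))"
    and "\<forall>t>0. emeasure N {s \<in> space N. f s > t * g s} > 0"
    and "\<alpha> \<ge> 0"
  shows "((\<exists>u\<ge>0. rv_regvar M \<alpha> (\<lambda>\<omega>. max (X \<omega>) u / max (Y \<omega>) u))
            \<longleftrightarrow> (\<forall>u\<ge>0. rv_regvar M \<alpha> (\<lambda>\<omega>. max (X \<omega>) u / max (Y \<omega>) u)))
       \<and> ((\<forall>u\<ge>0. rv_regvar M \<alpha> (\<lambda>\<omega>. max (X \<omega>) u / max (Y \<omega>) u))
            \<longleftrightarrow> regvar \<alpha> (gamma_fun N f g))"
proof -
  interpret spectral_rv M N f g X Y
  proof (intro spectral_rv.intro spectral_pair.intro spectral_rv_axioms.intro)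
    show "prob_space M" "X \<in> borel_measurable M" "Y \<in> borel_measurable M"
      "f \<in> borel_measurable N" "g \<in> borel_measurable N"
      "(\<integral>\<^sup>+ s. ennreal (f s) \<partial>N) = 1" "(\<integral>\<^sup>+ s. ennreal (g s) \<partial>N) = 1"
      by fact+
  qed (use assms(8,9,12) in blast)+
  have "rv_regvar M \<alpha> (\<lambda>\<omega>. max (X \<omega>) u / max (Y \<omega>) u) \<longleftrightarrow> regvar \<alpha> (gamma_fun N f g)"
    if "0 \<le> u" for u
    using rv_regvar_ratio_iff[OF that] .
  \<comment> \<open>Each \<open>u\<close> gives the same condition on \<open>\<gamma>\<close>, and
    admissible \<open>u\<close> exist, so the two quantifiers agree.\<close>
  then show ?thesis by blast
qed

end
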